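(* Let $n\ge 2$ be an integer, let $N\neq 0$ be a real number and put $\alpha=2N$. Let $P:\mathbb{R}^n\to\mathbb{R}$ be the Rosenbrock function, $\Xi:\mathbb{R}^n\times\mathbb{R}^{n-1}\to\mathbb{R}$ the total complementary function, $\mathcal{S}_a$ the canonical dual feasible space and $P^d:\mathcal{S}_a\to\mathbb{R}$ the canonical dual function, as defined in the context. If $\bar{\varsigma}=(\bar\varsigma_1,\dots,\bar\varsigma_{n-1})\in\mathcal{S}_a$ is a critical point of $P^d$ on $\mathcal{S}_a$, then the vector $\bar{x}=(\bar x_1,\dots,\bar x_n)\in\mathbb{R}^n$ defined by $$\bar x_i=\frac{\bar\varsigma_{i-1}+2}{2(\bar\varsigma_i+1)},\quad i=1,\dots,n-1,\qquad \bar x_n=\bar x_{n-1}^2,$$ with the convention $\bar\varsigma_0=0$, is a critical point of $P$ (i.e. $\nabla P(\bar x)=0$), and $$P(\bar x)=\Xi(\bar x,\bar\varsigma)=P^d(\bar\varsigma).$$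
   Context: For $x=(x_1,\dots,x_n)\in\mathbb{R}^n$ the Rosenbrock function is $$P(x)=\sum_{i=1}^{n-1}\left[(x_i-1)^2+\tfrac12\alpha\,(x_{i+1}-x_i^2)^2\right].$$ For $x\in\mathbb{R}^n$ and $\varsigma\in\mathbb{R}^{n-1}$ the total complementary function is $$\Xi(x,\varsigma)=\sum_{i=1}^{n-1}\left[(x_i-1)^2+\varsigma_i(x_i^2-x_{i+1})-\tfrac12\alpha^{-1}\varsigma_i^2\right].$$ The canonical dual feasible space is $$\mathcal{S}_a=\{\varsigma\in\mathbb{R}^{n-1} : \varsigma_i+1\neq 0\ \text{for } i=1,\dots,n-2,\ \text{and } \varsigma_{n-1}=0\}.$$ With the convention $\varsigma_0=0$, the canonical dual function on $\mathcal{S}_a$ is $$P^d(\varsigma)=n-1-\sum_{i=1}^{n-1}\left[\frac{(\varsigma_{i-1}+2)^2}{4(\varsigma_i+1)}+\tfrac12\alpha^{-1}\varsigma_i^2\right].$$ A critical point of $P^d$ on $\mathcal{S}_a$ is a point $\bar\varsigma\in\mathcal{S}_a$ at which $\partial P^d/\partial\varsigma_i=0$ for all $i=1,\dots,n-2$; that is, $\varsigma_{n-1}$ is fixed to be $0$ and $P^d$ is regarded as a function of the free variables $\varsigma_1,\dots,\varsigma_{n-2}$ (for $n=2$ the single point of $\mathcal{S}_a$ is a critical point). *)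

theory Defs
  imports Complex_Main "HOL-Library.FuncSet"
begin

text \<open>
  The statement relates points of dimension n and n - 1, so a point of real m-space is
  a function on the indices 1, ..., m, extensional (i.e. undefined) elsewhere.
\<close>

definition rvec :: "nat \<Rightarrow> (nat \<Rightarrow> real) set" where
  "rvec m = {1..m} \<rightarrow>\<^sub>E UNIV"

definition has_partial_derivative ::
    "((nat \<Rightarrow> real) \<Rightarrow> real) \<Rightarrow> nat \<Rightarrow> real \<Rightarrow> (nat \<Rightarrow> real) \<Rightarrow> bool" where
  "has_partial_derivative f i D x \<longleftrightarrow>
     ((\<lambda>t. f (x(i := t))) has_real_derivative D) (at (x i))"

definition rosenbrock :: "nat \<Rightarrow> real \<Rightarrow> (nat \<Rightarrow> real) \<Rightarrow> real" where
  "rosenbrock n \<alpha> x =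
     (\<Sum>i = 1..n - 1. (x i - 1)\<^sup>2 + 1 / 2 * \<alpha> * (x (i + 1) - (x i)\<^sup>2)\<^sup>2)"

definition total_complementary ::
    "nat \<Rightarrow> real \<Rightarrow> (nat \<Rightarrow> real) \<Rightarrow> (nat \<Rightarrow> real) \<Rightarrow> real" where
  "total_complementary n \<alpha> x \<sigma> =
     (\<Sum>i = 1..n - 1. (x i - 1)\<^sup>2 + \<sigma> i * ((x i)\<^sup>2 - x (i + 1))
        - 1 / 2 * inverse \<alpha> * (\<sigma> i)\<^sup>2)"

definition dual_feasible :: "nat \<Rightarrow> (nat \<Rightarrow> real) set" where
  "dual_feasible n =
     {\<sigma> \<in> rvec (n - 1). (\<forall>i\<in>{1..n - 2}. \<sigma> i + 1 \<noteq> 0) \<and> \<sigma> (n - 1) = 0}"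

text \<open>Implements the convention that the dual coordinate of index 0 is 0.\<close>

definition dual_coord :: "(nat \<Rightarrow> real) \<Rightarrow> nat \<Rightarrow> real" where
  "dual_coord \<sigma> i = (if i = 0 then 0 else \<sigma> i)"

definition canonical_dual :: "nat \<Rightarrow> real \<Rightarrow> (nat \<Rightarrow> real) \<Rightarrow> real" where
  "canonical_dual n \<alpha> \<sigma> =
     real n - 1 - (\<Sum>i = 1..n - 1. (dual_coord \<sigma> (i - 1) + 2)\<^sup>2 / (4 * (\<sigma> i + 1))
        + 1 / 2 * inverse \<alpha> * (\<sigma> i)\<^sup>2)"

definition primal_critical_point :: "nat \<Rightarrow> real \<Rightarrow> (nat \<Rightarrow> real) \<Rightarrow> bool" where
  "primal_critical_point n \<alpha> x \<longleftrightarrow>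
     x \<in> rvec n \<and> (\<forall>i\<in>{1..n}. has_partial_derivative (rosenbrock n \<alpha>) i 0 x)"

text \<open>
  The coordinate of index n - 1 is fixed to 0 on the dual feasible space, so only the
  coordinates 1, ..., n - 2 are free; varying one of them slightly stays in that space.
\<close>

definition dual_critical_point :: "nat \<Rightarrow> real \<Rightarrow> (nat \<Rightarrow> real) \<Rightarrow> bool" where
  "dual_critical_point n \<alpha> \<sigma> \<longleftrightarrow>
     \<sigma> \<in> dual_feasible n \<and>
     (\<forall>i\<in>{1..n - 2}. has_partial_derivative (canonical_dual n \<alpha>) i 0 \<sigma>)"

end

(* Vanishing of the partial derivative of the dual function in direction i says
   that the i-th dual coordinate equals \<alpha> (x_i^2 - x_(i+1)), the formula for x_n being the same
   relation for i = n - 1. Inserting this into the gradient of the Rosenbrock function leaves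
   2 (\<sigma>_i + 1) x_i - (\<sigma>_(i-1) + 2), which vanishes by the choice of x. The first equality of
   values then holds summand by summand; the second one after shifting the index of the terms
   \<sigma>_i x_(i+1), no boundary terms arising because \<sigma>_0 = \<sigma>_(n-1) = 0. *)
theory Submission
  imports Defs
begin

lemma has_partial_derivative_unique:
  assumes "has_partial_derivative f i D x" "has_partial_derivative f i E x"
  shows "D = E"
  using assms DERIV_unique unfolding has_partial_derivative_def by blast

text \<open>The variable \<sigma>_i enters only two summands: summand i through its denominator and
  quadratic term, and summand i + 1 through its numerator. Their derivatives are \<open>D1\<close>
  and \<open>D2\<close>; the sum is subtracted in \<open>canonical_dual\<close>, hence the opposite
  signs.\<close>

lemma has_partial_derivative_canonical_dual:
  assumes i: "1 \<le> i" "i \<le> n - 2" and nz: "\<sigma> i + 1 \<noteq> 0"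
  shows "has_partial_derivative (canonical_dual n \<alpha>) i
    ((dual_coord \<sigma> (i - 1) + 2)\<^sup>2 / (4 * (\<sigma> i + 1)\<^sup>2) - inverse \<alpha> * \<sigma> i
      - (\<sigma> i + 2) / (2 * (\<sigma> (i + 1) + 1))) \<sigma>"
proof -
  define D1 where "D1 = inverse \<alpha> * \<sigma> i - (dual_coord \<sigma> (i - 1) + 2)\<^sup>2 / (4 * (\<sigma> i + 1)\<^sup>2)"
  define D2 where "D2 = (\<sigma> i + 2) / (2 * (\<sigma> (i + 1) + 1))"
  have summand: "((\<lambda>t. (dual_coord (\<sigma>(i := t)) (k - 1) + 2)\<^sup>2 / (4 * ((\<sigma>(i := t)) k + 1))
          + 1 / 2 * inverse \<alpha> * ((\<sigma>(i := t)) k)\<^sup>2)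
        has_real_derivative ((if k = i then D1 else 0) + (if k = i + 1 then D2 else 0))) (at (\<sigma> i))"
    if k: "k \<in> {1..n - 1}" for k
  proof -
    consider "k = i" | "k = i + 1" | "k \<noteq> i" "k - 1 \<noteq> i"
      using k by force
    then show ?thesis
    proof cases
      case 1
      have "dual_coord (\<sigma>(i := t)) (k - 1) = dual_coord \<sigma> (i - 1)" for t
        using 1 i by (cases i) (simp_all add: dual_coord_def)
      then show ?thesis
        \<comment> \<open>Distributing the 4 over \<open>\<sigma> i + 1\<close> would hide the
          nonzero factor in the denominator.\<close>
        using 1 nz unfolding D1_def
        by (auto intro!: derivative_eq_intros
            simp: power2_eq_square simp del: distrib_left_numeral distrib_right_numeral)
    next
      case 2
      have coord: "dual_coord (\<sigma>(i := t)) (k - 1) = t" for t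
        using 2 i by (simp add: dual_coord_def)
      have "((\<lambda>t. (t + 2)\<^sup>2 / c + d) has_real_derivative 2 * (\<sigma> i + 2) / c) (at (\<sigma> i))"
        for c d :: real
        \<comment> \<open>For \<open>c = 0\<close> division yields 0, so the function is constant
          and the claimed derivative is 0 as well.\<close>
        by (cases "c = 0") (auto intro!: derivative_eq_intros)
      note this[of "4 * (\<sigma> (i + 1) + 1)" "1 / 2 * inverse \<alpha> * (\<sigma> (i + 1))\<^sup>2"]
      moreover have "D2 = 2 * (\<sigma> i + 2) / (4 * (\<sigma> (i + 1) + 1))"
        unfolding D2_def by (simp del: distrib_left_numeral distrib_right_numeral)
      ultimately show ?thesis
        using 2 coord by (simp del: distrib_left_numeral distrib_right_numeral)
    next
      case 3
      then have "k \<noteq> i + 1"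
        by auto
      moreover have "dual_coord (\<sigma>(i := t)) (k - 1) = dual_coord \<sigma> (k - 1)" for t
        using 3 by (simp add: dual_coord_def)
      ultimately show ?thesis
        using 3 by simp
    qed
  qed
  \<comment> \<open>Since \<open>i \<le> n - 2\<close>, both indices lie in the summation range, so
    each conditional contributes exactly once.\<close>
  have "i \<in> {1..n - 1}" "i + 1 \<in> {1..n - 1}"
    using i by auto
  then have total: "(dual_coord \<sigma> (i - 1) + 2)\<^sup>2 / (4 * (\<sigma> i + 1)\<^sup>2) - inverse \<alpha> * \<sigma> i
      - (\<sigma> i + 2) / (2 * (\<sigma> (i + 1) + 1))
      = 0 - (\<Sum>k = 1..n - 1. (if k = i then D1 else 0) + (if k = i + 1 then D2 else 0))"
    by (simp add: sum.distrib D1_def D2_def)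
  show ?thesis
    unfolding has_partial_derivative_def canonical_dual_def total
    by (intro DERIV_diff DERIV_const DERIV_sum summand)
qed

text \<open>Only summands i and i - 1 involve x_i. The first is absent for \<open>i = n\<close>, the
  second for \<open>i = 1\<close>, which accounts for the two conditionals.\<close>

lemma has_partial_derivative_rosenbrock:
  assumes i: "1 \<le> i" "i \<le> n"
  shows "has_partial_derivative (rosenbrock n \<alpha>) i
    ((if i < n then 2 * (x i - 1) - 2 * \<alpha> * x i * (x (i + 1) - (x i)\<^sup>2) else 0)
      + (if 1 < i then \<alpha> * (x i - (x (i - 1))\<^sup>2) else 0)) x"
proof -
  define D1 where "D1 = 2 * (x i - 1) - 2 * \<alpha> * x i * (x (i + 1) - (x i)\<^sup>2)"
  define D2 where "D2 = \<alpha> * (x i - (x (i - 1))\<^sup>2)"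
  have summand: "((\<lambda>t. ((x(i := t)) k - 1)\<^sup>2
          + 1 / 2 * \<alpha> * ((x(i := t)) (k + 1) - ((x(i := t)) k)\<^sup>2)\<^sup>2)
        has_real_derivative ((if k = i then D1 else 0) + (if k = i - 1 then D2 else 0))) (at (x i))"
    if k: "k \<in> {1..n - 1}" for k
  proof -
    consider "k = i" | "k = i - 1" "k + 1 = i" | "k \<noteq> i" "k + 1 \<noteq> i" "k \<noteq> i - 1"
      using k by force
    then show ?thesis
    proof cases
      case 1
      then have "k \<noteq> i - 1"
        using k by auto
      with 1 show ?thesis
        unfolding D1_def by (auto intro!: derivative_eq_intros simp: field_simps)
    next
      case 2
      then have "k \<noteq> i"
        by auto
      with 2 show ?thesis
        unfolding D2_def by (auto intro!: derivative_eq_intros)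
    next
      case 3
      then show ?thesis
        by simp
    qed
  qed
  \<comment> \<open>At \<open>i = 1\<close> the index \<open>i - 1\<close> is 0 and falls outside
    the range, so no term is counted wrongly.\<close>
  have "i \<in> {1..n - 1} \<longleftrightarrow> i < n" "i - 1 \<in> {1..n - 1} \<longleftrightarrow> 1 < i"
    using i by auto
  then have total: "(if i < n then D1 else 0) + (if 1 < i then D2 else 0)
      = (\<Sum>k = 1..n - 1. (if k = i then D1 else 0) + (if k = i - 1 then D2 else 0))"
    by (simp add: sum.distrib)
  show ?thesis
    unfolding has_partial_derivative_def rosenbrock_def D1_def[symmetric] D2_def[symmetric] total
    by (intro DERIV_sum summand)
qed

text \<open>For a general upper limit k the shift leaves the boundary term \<sigma>_k y_(k+1). With
  this term kept, the identity follows by induction, and at m the term vanishes.\<close>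

lemma sum_dual_coord_shift:
  assumes "m \<ge> 1" "\<sigma> m = 0"
  shows "(\<Sum>i = 1..m. \<sigma> i * y (i + 1)) = (\<Sum>i = 1..m. dual_coord \<sigma> (i - 1) * y i)"
proof -
  have "(\<Sum>i = 1..k. dual_coord \<sigma> (i - 1) * y i) + dual_coord \<sigma> k * y (k + 1)
      = (\<Sum>i = 1..k. \<sigma> i * y (i + 1))" for k
    by (induction k) (auto simp: dual_coord_def)
  from this[of m] show ?thesis
    using assms by (simp add: dual_coord_def)
qed

theorem theorem1:
  fixes n :: nat and N \<alpha> :: real and \<sigma> x :: "nat \<Rightarrow> real"
  assumes "n \<ge> 2" and "N \<noteq> 0" and "\<alpha> = 2 * N"
    and "dual_critical_point n \<alpha> \<sigma>"
    and "x \<in> rvec n"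
    and "\<forall>i\<in>{1..n - 1}. x i = (dual_coord \<sigma> (i - 1) + 2) / (2 * (\<sigma> i + 1))"
    and "x n = (x (n - 1))\<^sup>2"
  shows "primal_critical_point n \<alpha> x \<and>
    rosenbrock n \<alpha> x = total_complementary n \<alpha> x \<sigma> \<and>
    total_complementary n \<alpha> x \<sigma> = canonical_dual n \<alpha> \<sigma>"
proof (intro conjI)
  have \<alpha>: "\<alpha> \<noteq> 0"
    using assms by simp
  have last: "\<sigma> (n - 1) = 0"
    using assms by (simp add: dual_critical_point_def dual_feasible_def)
  \<comment> \<open>Feasibility covers the indices up to \<open>n - 2\<close>; at
    \<open>n - 1\<close> the value is 0 + 1.\<close>
  have nz: "\<sigma> i + 1 \<noteq> 0" if "i \<in> {1..n - 1}" for i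
  proof (cases "i = n - 1")
    case False
    with that have "i \<in> {1..n - 2}"
      by auto
    then show ?thesis
      using assms(4) by (auto simp: dual_critical_point_def dual_feasible_def)
  qed (use last in simp)
  have x: "2 * (\<sigma> i + 1) * x i = dual_coord \<sigma> (i - 1) + 2" if "i \<in> {1..n - 1}" for i
    using assms(6) nz[OF that] that by simp
  have \<sigma>: "\<sigma> i = \<alpha> * ((x i)\<^sup>2 - x (i + 1))" if i: "i \<in> {1..n - 1}" for i
  proof (cases "i = n - 1")
    case True
    with assms(1,7) last show ?thesis
      by simp
  next
    case False
    with i have i': "i \<in> {1..n - 2}" "i + 1 \<in> {1..n - 1}"
      by auto
    have "x i = (dual_coord \<sigma> (i - 1) + 2) / (2 * (\<sigma> i + 1))"
      using assms(6) i by blast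
    then have xi: "(x i)\<^sup>2 = (dual_coord \<sigma> (i - 1) + 2)\<^sup>2 / (4 * (\<sigma> i + 1)\<^sup>2)"
      by (simp only: power_divide power_mult_distrib) simp
    have "x (i + 1) = (dual_coord \<sigma> (i + 1 - 1) + 2) / (2 * (\<sigma> (i + 1) + 1))"
      using assms(6) i'(2) by blast
    then have xi': "x (i + 1) = (\<sigma> i + 2) / (2 * (\<sigma> (i + 1) + 1))"
      using i by (simp add: dual_coord_def)
    \<comment> \<open>The quotients in the general derivative formula are exactly x_i^2 and x_(i+1).
      Comparing with the derivative 0 then gives an equation that is solved for \<sigma>_i.\<close>
    have "has_partial_derivative (canonical_dual n \<alpha>) i
        ((x i)\<^sup>2 - inverse \<alpha> * \<sigma> i - x (i + 1)) \<sigma>"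
      unfolding xi xi' using i' nz[OF i] by (intro has_partial_derivative_canonical_dual) auto
    moreover have "has_partial_derivative (canonical_dual n \<alpha>) i 0 \<sigma>"
      using assms(4) i' by (simp add: dual_critical_point_def)
    ultimately have "(x i)\<^sup>2 - inverse \<alpha> * \<sigma> i - x (i + 1) = 0"
      by (rule has_partial_derivative_unique)
    with \<alpha> show ?thesis
      by (simp add: field_simps)
  qed

  show "primal_critical_point n \<alpha> x"
    unfolding primal_critical_point_def
  proof (intro conjI ballI)
    fix i assume i: "i \<in> {1..n}"
    \<comment> \<open>Summands i and i - 1 contribute \<sigma>_(i-1) and -\<sigma>_(i-1) to the
      gradient. This persists at the ends: a missing summand matches \<sigma>_(n-1) = 0 or
      \<sigma>_0 = 0.\<close>
    have upper: "(if i < n then 2 * (x i - 1) - 2 * \<alpha> * x i * (x (i + 1) - (x i)\<^sup>2) else 0)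
        = dual_coord \<sigma> (i - 1)"
    proof (cases "i < n")
      case True
      with i have i': "i \<in> {1..n - 1}"
        by auto
      have "2 * (x i - 1) - 2 * \<alpha> * x i * (x (i + 1) - (x i)\<^sup>2)
          = 2 * (x i - 1) + 2 * (\<alpha> * ((x i)\<^sup>2 - x (i + 1))) * x i"
        by algebra
      also have "\<dots> = 2 * (\<sigma> i + 1) * x i - 2"
        unfolding \<sigma>[OF i', symmetric] by algebra
      finally show ?thesis
        using True x[OF i'] by simp
    next
      case False
      with i assms(1) last show ?thesis
        by (simp add: dual_coord_def)
    qed
    have lower: "(if 1 < i then \<alpha> * (x i - (x (i - 1))\<^sup>2) else 0) = - dual_coord \<sigma> (i - 1)"
    proof (cases "1 < i")
      case True
      with i have "i - 1 \<in> {1..n - 1}"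
        by auto
      from \<sigma>[OF this] True show ?thesis
        by (simp add: dual_coord_def algebra_simps)
    qed (use i in \<open>simp add: dual_coord_def\<close>)
    show "has_partial_derivative (rosenbrock n \<alpha>) i 0 x"
      using has_partial_derivative_rosenbrock[of i n \<alpha> x] i unfolding upper lower by simp
  qed (fact assms(5))

  show "rosenbrock n \<alpha> x = total_complementary n \<alpha> x \<sigma>"
    unfolding rosenbrock_def total_complementary_def
  proof (rule sum.cong)
    fix i assume "i \<in> {1..n - 1}"
    show "(x i - 1)\<^sup>2 + 1 / 2 * \<alpha> * (x (i + 1) - (x i)\<^sup>2)\<^sup>2
        = (x i - 1)\<^sup>2 + \<sigma> i * ((x i)\<^sup>2 - x (i + 1)) - 1 / 2 * inverse \<alpha> * (\<sigma> i)\<^sup>2"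
      \<comment> \<open>With u = x_i^2 - x_(i+1) and \<sigma>_i = \<alpha> u, the dual terms become
        \<alpha> u^2 - \<alpha> u^2 / 2.\<close>
      unfolding \<sigma>[OF \<open>i \<in> {1..n - 1}\<close>] using \<alpha>
      by (simp add: field_simps power2_eq_square)
  qed simp

  \<comment> \<open>The terms \<sigma>_i x_(i+1) are split off so that, once shifted, summand i
    contains no coordinate of x except x_i.\<close>
  have "total_complementary n \<alpha> x \<sigma>
      = (\<Sum>i = 1..n - 1. (x i - 1)\<^sup>2 + \<sigma> i * (x i)\<^sup>2 - 1 / 2 * inverse \<alpha> * (\<sigma> i)\<^sup>2)
        - (\<Sum>i = 1..n - 1. \<sigma> i * x (i + 1))"
    unfolding total_complementary_def sum_subtractf[symmetric]
    by (intro sum.cong) (simp_all add: algebra_simps)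
  also have "\<dots> = (\<Sum>i = 1..n - 1. (x i - 1)\<^sup>2 + \<sigma> i * (x i)\<^sup>2 - 1 / 2 * inverse \<alpha> * (\<sigma> i)\<^sup>2
        - dual_coord \<sigma> (i - 1) * x i)"
    using assms(1) last by (subst sum_dual_coord_shift) (simp_all add: sum_subtractf)
  also have "\<dots> = (\<Sum>i = 1..n - 1. 1 - ((dual_coord \<sigma> (i - 1) + 2)\<^sup>2 / (4 * (\<sigma> i + 1))
        + 1 / 2 * inverse \<alpha> * (\<sigma> i)\<^sup>2))"
  proof (rule sum.cong)
    fix i assume i: "i \<in> {1..n - 1}"
    \<comment> \<open>Write s = \<sigma>_(i-1). The summand without its \<alpha>-term is (\<sigma>_i
      + 1) x_i^2 - (s + 2) x_i + 1, and s + 2 = 2 (\<sigma>_i + 1) x_i turns it into 1 - (\<sigma>_i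
      + 1) x_i^2.\<close>
    have quotient: "(dual_coord \<sigma> (i - 1) + 2)\<^sup>2 / (4 * (\<sigma> i + 1)) = (\<sigma> i + 1) * (x i)\<^sup>2"
      using nz[OF i] unfolding x[OF i, symmetric]
      by (simp add: power2_eq_square del: distrib_left_numeral distrib_right_numeral)
    have coord: "dual_coord \<sigma> (i - 1) = 2 * (\<sigma> i + 1) * x i - 2"
      using x[OF i] by simp
    show "(x i - 1)\<^sup>2 + \<sigma> i * (x i)\<^sup>2 - 1 / 2 * inverse \<alpha> * (\<sigma> i)\<^sup>2
          - dual_coord \<sigma> (i - 1) * x i
        = 1 - ((dual_coord \<sigma> (i - 1) + 2)\<^sup>2 / (4 * (\<sigma> i + 1)) + 1 / 2 * inverse \<alpha> * (\<sigma> i)\<^sup>2)"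
      \<comment> \<open>The order matters: \<open>coord\<close> would also rewrite the numerator
        that \<open>quotient\<close> has to match.\<close>
      unfolding quotient unfolding coord by (simp add: power2_eq_square algebra_simps)
  qed simp
  also have "\<dots> = canonical_dual n \<alpha> \<sigma>"
    using assms(1) unfolding canonical_dual_def by (simp add: sum_subtractf of_nat_diff)
  finally show "total_complementary n \<alpha> x \<sigma> = canonical_dual n \<alpha> \<sigma>" .
qed

end
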